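(* Let $n\ge 1$ be an integer, let $B$ be the open unit ball of $\mathbb{R}^{n+1}$, and let $\delta>0$. Let $w:(0,\infty)\to(0,\infty)$ be a strictly decreasing $C^2$ function with $\lim_{y\to 0}w(y)=\infty$ and $w(1)=1$, such that $$\lim_{y\to 0}\frac{w(y)}{w'(y)}=0\qquad\text{and}\qquad \left(\frac{w(y)}{w'(y)}\right)'\ge -\frac{1-\delta}{n}\quad\text{for } 0<y<1 .$$ Let $U$ be a harmonic function in $B$ with $U(0)=0$ and $$U(z)\le w(1-|z|),\quad z\in B .$$ Then $$|U(z)|\le C\,w(1-|z|),\quad z\in B,$$ where the constant $C=C(n,\delta)$ depends only on $\delta$ and the dimension $n$.
   Context: The conditions on $w/w'$ presuppose that $w'$ does not vanish where the quotient is used. No other notation is needed. *)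

theory Defs
  imports "HOL-Analysis.Analysis"
begin

definition partial :: "'a::euclidean_space \<Rightarrow> ('a \<Rightarrow> real) \<Rightarrow> 'a \<Rightarrow> real" where
  "partial b f x = frechet_derivative f (at x) b"

text \<open>
  Intended for open S, where this is the usual class C2: a function whose first order partial
  derivatives have continuous partial derivatives is itself twice differentiable in the
  Frechet sense, so asking for differentiability is no extra restriction.
\<close>

definition C2_on :: "'a::euclidean_space set \<Rightarrow> ('a \<Rightarrow> real) \<Rightarrow> bool" where
  "C2_on S f \<longleftrightarrow>
     (\<forall>x\<in>S. f differentiable (at x)) \<and>
     (\<forall>b\<in>Basis. \<forall>x\<in>S. partial b f differentiable (at x)) \<and>
     (\<forall>b\<in>Basis. \<forall>c\<in>Basis. continuous_on S (partial c (partial b f)))"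

definition laplacian :: "('a::euclidean_space \<Rightarrow> real) \<Rightarrow> 'a \<Rightarrow> real" where
  "laplacian f x = (\<Sum>b\<in>Basis. partial b (partial b f) x)"

definition harmonic_on :: "'a::euclidean_space set \<Rightarrow> ('a \<Rightarrow> real) \<Rightarrow> bool" where
  "harmonic_on S f \<longleftrightarrow> C2_on S f \<and> (\<forall>x\<in>S. laplacian f x = 0)"

end

theory Submission
  imports Defs
begin

text \<open>
  Put \<open>q = - w / w'\<close>, \<open>\<kappa> = (1 - \<delta>) / n\<close> and \<open>\<alpha> = 1 / \<kappa>\<close>. The hypotheses say that \<open>q > 0\<close>, that \<open>q\<close>
  tends to 0 at the origin and that \<open>q' \<le> \<kappa>\<close>; hence \<open>q y \<le> \<kappa> y\<close>, which forces \<open>\<delta> < 1\<close>, so that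
  \<open>\<alpha> > n\<close>. The exponent \<open>n\<close> is critical: the negative of the Poisson kernel is bounded above by 0,
  but near its pole it is as negative as minus the \<open>n\<close>-th power of the inverse distance to the sphere.

  Two ideas carry the proof. The first reduces \<open>w\<close> to a pure power. Fix the distance \<open>y\<close> of a
  point \<open>z\<close> to the unit sphere. The length on which \<open>w\<close> changes by a bounded factor near \<open>y\<close> is
  \<open>h = q y / (2 \<kappa>)\<close>, and integrating \<open>(ln w)' = - 1 / q\<close> with the bound on the slope of \<open>q\<close> shows
  that \<open>w (y - h + t)\<close> is at most a constant times \<open>w y\<close> times \<open>(t / h) powr - \<alpha>\<close> for every \<open>t > 0\<close>
  with \<open>y - h + t < 1\<close> (\<open>weight_decay\<close>). So on the ball of radius \<open>1 - (y - h)\<close> the function \<open>U\<close> has a majorant of order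
  \<open>t powr - \<alpha>\<close>, with \<open>t\<close> the distance to the boundary of that smaller ball, and the point \<open>z\<close> has
  \<open>t = h\<close>, where the majorant is comparable with \<open>w y\<close>.

  The second idea is that a power majorant with \<open>\<alpha> > n\<close> passes to \<open>- U\<close>, along the radius through
  \<open>z\<close> and starting from \<open>U 0 = 0\<close>. In going from the distance \<open>t\<close> to the distance \<open>\<rho> t\<close>, Harnack's
  inequality for majorant minus \<open>U\<close> costs a factor \<open>C \<rho> powr - n\<close>, where \<open>C\<close> does not depend on \<open>\<rho>\<close>
  (\<open>harnack_step_on_ray\<close>), while the bound to be proved grows by \<open>\<rho> powr - \<alpha>\<close>. As \<open>\<alpha> > n\<close>, a small
  fixed \<open>\<rho>\<close> makes the growth beat the cost, and the estimate propagates through all scales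
  (\<open>power_growth_lower_bound\<close>).

  It matters that Harnack's inequality has the exponent \<open>n\<close>. Comparing the mean values over two
  balls would only give the dimension \<open>n + 1\<close> as exponent. The exponent \<open>n\<close> comes from the mean value property over
  balls (\<open>harmonic_ball_mean\<close>): a small ball around a point at distance \<open>s\<close> from \<open>c\<close> lies in a thin
  shell between two balls around \<open>c\<close>, and the integral over the shell is the value at \<open>c\<close> times
  the volume of the shell (\<open>harmonic_harnack\<close>).
\<close>

section \<open>The mean value property of harmonic functions over balls\<close>

lemma integral_eq_integral_UNIV_if_supported:
  fixes f :: "'a::euclidean_space \<Rightarrow> real"
  assumes "\<And>y. y \<notin> S \<Longrightarrow> f y = 0"
  shows "integral S f = integral UNIV f"
proof -
  have "(\<lambda>y. if y \<in> S then f y else 0) = f"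
    using assms by auto
  then show ?thesis
    using integral_restrict_UNIV[of S f] by simp
qed

lemma unit_ball_subset_cube:
  fixes y :: "'a::euclidean_space"
  assumes "norm y < 1" "a \<ge> 1"
  shows "y \<in> cbox (- (a *\<^sub>R One)) (a *\<^sub>R One)"
proof -
  have "\<bar>y \<bullet> i\<bar> < 1" if "i \<in> Basis" for i
    using Basis_le_norm[OF that, of y] assms by linarith
  then show ?thesis
    using assms by (fastforce simp: mem_box)
qed

text \<open>
  This is the divergence theorem for a compactly supported field, one component at a time. The
  integral of \<open>H\<close> shifted along \<open>b\<close> does not depend on the shift, and its derivative with respect
  to the shift is the integral of \<open>D\<close>.
\<close>

lemma integral_directional_derivative_eq_0:
  fixes H D :: "'a::euclidean_space \<Rightarrow> real"
  assumes b: "b \<in> Basis"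
    and contH: "continuous_on UNIV H" and contD: "continuous_on UNIV D"
    and der: "\<And>y. ((\<lambda>t. H (y + t *\<^sub>R b)) has_field_derivative D y) (at 0)"
    and supp: "\<And>y. norm y \<ge> 1 \<Longrightarrow> H y = 0"
    and suppD: "\<And>y. norm y \<ge> 1 \<Longrightarrow> D y = 0"
  shows "integral UNIV D = 0"
proof -
  \<comment> \<open>The support of every shift of \<open>H\<close> by at most 1 lies in this cube.\<close>
  define Q :: "'a set" where "Q = cbox (- (2 *\<^sub>R One)) (2 *\<^sub>R One)"
  have der': "((\<lambda>t. H (y + t *\<^sub>R b)) has_field_derivative D (y + s *\<^sub>R b)) (at s)" for y s
    using der[of "y + s *\<^sub>R b"] DERIV_shift[of "\<lambda>t. H (y + t *\<^sub>R b)" "D (y + s *\<^sub>R b)" 0 s]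
    by (simp add: algebra_simps)
  have "((\<lambda>t. integral Q (\<lambda>y. H (y + t *\<^sub>R b))) has_field_derivative
      integral Q (\<lambda>y. D (y + 0 *\<^sub>R b))) (at 0 within {-1..1})"
    unfolding Q_def
  proof (rule leibniz_rule_field_derivative[where fx = "\<lambda>t y. D (y + t *\<^sub>R b)"])
    show "((\<lambda>t. H (y + t *\<^sub>R b)) has_field_derivative D (y + t *\<^sub>R b)) (at t within {-1..1})"
      for t y
      using der' by (rule has_field_derivative_at_within)
    show "(\<lambda>y. H (y + t *\<^sub>R b)) integrable_on cbox (- (2 *\<^sub>R One)) (2 *\<^sub>R One)" for t
      by (intro integrable_continuous continuous_on_compose2[OF contH] continuous_intros) auto
    show "continuous_on ({-1..1} \<times> cbox (- (2 *\<^sub>R One)) (2 *\<^sub>R One)) (\<lambda>(t, y). D (y + t *\<^sub>R b))"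
      unfolding split_beta
      by (intro continuous_on_compose2[OF contD] continuous_intros) auto
  qed auto
  moreover have "integral Q (\<lambda>y. H (y + t *\<^sub>R b)) = integral UNIV H" if "t \<in> {-1..1}" for t
  proof -
    have "integral Q (\<lambda>y. H (y + t *\<^sub>R b))
        = integral (cbox (- (2 *\<^sub>R One) + t *\<^sub>R b) (2 *\<^sub>R One + t *\<^sub>R b)) H"
      using integral_shift_cbox_plus[of "- (2 *\<^sub>R One)" "2 *\<^sub>R One" H "t *\<^sub>R b"]
      by (simp add: Q_def o_def add.commute)
    also have "\<dots> = integral UNIV H"
    proof (rule integral_eq_integral_UNIV_if_supported)
      fix y assume y: "y \<notin> cbox (- (2 *\<^sub>R One) + t *\<^sub>R b) (2 *\<^sub>R One + t *\<^sub>R b)"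
      have "norm y \<ge> 1"
      proof (rule ccontr)
        assume "\<not> norm y \<ge> 1"
        then have "\<bar>y \<bullet> i\<bar> < 1" if "i \<in> Basis" for i
          using Basis_le_norm[OF that, of y] by linarith
        moreover have "\<bar>t * (b \<bullet> i)\<bar> \<le> 1" if "i \<in> Basis" for i
          using \<open>t \<in> _\<close> b that by (auto simp: inner_Basis)
        ultimately have "y \<in> cbox (- (2 *\<^sub>R One) + t *\<^sub>R b) (2 *\<^sub>R One + t *\<^sub>R b)"
          unfolding mem_box by (fastforce simp: inner_add_left inner_diff_left abs_le_iff abs_less_iff)
        with y show False by simp
      qed
      then show "H y = 0" by (rule supp)
    qed
    finally show ?thesis .
  qed
  ultimately have "((\<lambda>t. integral UNIV H) has_field_derivative integral Q D) (at (0::real) within {-1..1})"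
    using has_field_derivative_transform_within[where d = 1 and g = "\<lambda>t. integral UNIV H"
        and f = "\<lambda>t. integral Q (\<lambda>y. H (y + t *\<^sub>R b))" and a = 0 and S = "{-1..1::real}"]
    by simp
  then have "((\<lambda>t. integral UNIV H) has_field_derivative integral Q D) (at (0::real))"
    using at_within_Icc_at[of "-1::real" 0 1] by simp
  then have "integral Q D = 0"
    by (rule DERIV_unique) (rule DERIV_const)
  moreover have "integral Q D = integral UNIV D"
  proof (rule integral_eq_integral_UNIV_if_supported)
    fix y assume "y \<notin> Q"
    then have "norm y \<ge> 1"
      using unit_ball_subset_cube[of y 2] by (force simp: Q_def)
    then show "D y = 0" by (rule suppD)
  qed
  ultimately show ?thesis by simp
qed

lemma C2_on_has_derivative:
  fixes f :: "'a::euclidean_space \<Rightarrow> real"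
  assumes "C2_on S f" "x \<in> S"
  shows "(f has_derivative (\<lambda>h. \<Sum>b\<in>Basis. (h \<bullet> b) * partial b f x)) (at x)"
proof -
  have d: "(f has_derivative frechet_derivative f (at x)) (at x)"
    using assms by (simp add: C2_on_def frechet_derivative_works)
  have "frechet_derivative f (at x) = (\<lambda>h. \<Sum>b\<in>Basis. (h \<bullet> b) * partial b f x)"
  proof
    fix h
    have "frechet_derivative f (at x) (\<Sum>b\<in>Basis. (h \<bullet> b) *\<^sub>R b) =
        (\<Sum>b\<in>Basis. (h \<bullet> b) * partial b f x)"
      using has_derivative_linear[OF d]
      by (simp add: linear_sum linear_scale partial_def)
    then show "frechet_derivative f (at x) h = (\<Sum>b\<in>Basis. (h \<bullet> b) * partial b f x)"
      by (simp add: euclidean_representation)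
  qed
  with d show ?thesis by simp
qed

lemma has_derivative_along_line:
  fixes f :: "'a::euclidean_space \<Rightarrow> real"
  assumes "f differentiable (at x)"
  shows "((\<lambda>t. f (x + (r * t) *\<^sub>R b)) has_field_derivative r * partial b f x) (at 0)"
proof -
  have d: "(f has_derivative frechet_derivative f (at x)) (at x)"
    using assms by (simp add: frechet_derivative_works)
  have "((\<lambda>t. x + (r * t) *\<^sub>R b) has_derivative (\<lambda>t. (r * t) *\<^sub>R b)) (at 0)"
    by (auto intro!: derivative_eq_intros)
  moreover have "(f has_derivative frechet_derivative f (at x)) (at (x + (r * 0) *\<^sub>R b))"
    using d by simp
  ultimately have "((\<lambda>t. f (x + (r * t) *\<^sub>R b)) has_derivative
      (\<lambda>t. frechet_derivative f (at x) ((r * t) *\<^sub>R b))) (at 0)"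
    by (rule has_derivative_compose)
  moreover have "frechet_derivative f (at x) ((r * t) *\<^sub>R b) = (r * partial b f x) * t" for t
    using linear_scale[OF has_derivative_linear[OF d], of "r * t" b]
    by (simp add: partial_def)
  ultimately show ?thesis
    by (simp add: has_field_derivative_def)
qed

text \<open>
  The function \<open>h\<close> may be wild outside the ball, but there it is multiplied by zero. Replacing \<open>y\<close> by
  its retraction to the unit ball in the argument of \<open>h\<close> does not change the product and makes it a
  composition of continuous functions.
\<close>

lemma continuous_on_cutoff:
  fixes h :: "'a::euclidean_space \<Rightarrow> real" and g :: "real \<Rightarrow> real"
  assumes h: "continuous_on (ball c R) h" and g: "continuous_on UNIV g"
    and supp: "\<And>s. s \<ge> 1 \<Longrightarrow> g s = 0" and R: "r < R"
  shows "continuous_on ({0..r} \<times> UNIV) (\<lambda>p. g (snd p \<bullet> snd p) * h (c + fst p *\<^sub>R snd p))"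
proof -
  define k :: "'a \<Rightarrow> 'a" where "k y = y /\<^sub>R max 1 (norm y)" for y
  have k: "norm (k y) \<le> 1" for y
    by (simp add: k_def divide_simps)
  have "continuous_on ({0..r} \<times> UNIV) (\<lambda>p. g (snd p \<bullet> snd p) * h (c + fst p *\<^sub>R k (snd p)))"
  proof (intro continuous_intros continuous_on_compose2[OF g] continuous_on_compose2[OF h])
    show "continuous_on ({0..r} \<times> UNIV) (\<lambda>p::real \<times> 'a. k (snd p))"
      unfolding k_def by (intro continuous_intros) auto
    show "(\<lambda>p. c + fst p *\<^sub>R k (snd p)) ` ({0..r} \<times> UNIV) \<subseteq> ball c R"
    proof clarsimp
      fix t y assume "0 \<le> t" "t \<le> r"
      then have "t * norm (k y) \<le> r * 1"
        by (intro mult_mono k) auto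
      with R \<open>0 \<le> t\<close> show "dist c (c + t *\<^sub>R k y) < R"
        by (simp add: dist_norm)
    qed
  qed auto
  moreover have "g (y \<bullet> y) * h (c + t *\<^sub>R k y) = g (y \<bullet> y) * h (c + t *\<^sub>R y)" for t y
  proof (cases "norm y \<le> 1")
    case True
    then show ?thesis by (simp add: k_def)
  next
    case False
    then have "y \<bullet> y \<ge> 1"
      by (simp add: norm_eq_sqrt_inner)
    then show ?thesis by (simp add: supp)
  qed
  ultimately show ?thesis
    by simp
qed

lemma continuous_on_cutoff_slice:
  fixes h :: "'a::euclidean_space \<Rightarrow> real" and g :: "real \<Rightarrow> real"
  assumes "continuous_on (ball c R) h" "continuous_on UNIV g"
    and "\<And>s. s \<ge> 1 \<Longrightarrow> g s = 0" "r < R" "t \<in> {0..r}"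
  shows "continuous_on UNIV (\<lambda>y. g (y \<bullet> y) * h (c + t *\<^sub>R y))"
proof -
  have "continuous_on UNIV (Pair t :: 'a \<Rightarrow> _)"
    by (intro continuous_intros)
  moreover have "range (Pair t :: 'a \<Rightarrow> _) \<subseteq> {0..r} \<times> UNIV"
    using assms(5) by auto
  ultimately show ?thesis
    using continuous_on_compose2[OF continuous_on_cutoff[of c R h g r]] assms by fastforce
qed

lemma ex_compactly_supported_antiderivative:
  fixes g :: "real \<Rightarrow> real"
  assumes cont: "continuous_on UNIV g" and supp: "\<And>s. s \<ge> 1 \<Longrightarrow> g s = 0"
  obtains G where "\<And>s. (G has_field_derivative g s) (at s)" "\<And>s. s \<ge> 1 \<Longrightarrow> G s = 0"
proof -
  have "isCont g x" for x
    using cont by (simp add: continuous_on_eq_continuous_at)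
  then obtain F where F: "\<And>x. (F has_field_derivative g x) (at x)"
    using einterval_antiderivative[of "-\<infinity>" \<infinity> g]
    by (auto simp: has_real_derivative_iff_has_vector_derivative)
  have "((\<lambda>s. F s - F 1) has_field_derivative g s) (at s)" for s
    using F[of s] by (auto intro!: derivative_eq_intros)
  moreover have "F s - F 1 = 0" if "s \<ge> 1" for s
  proof -
    have "\<exists>k. \<forall>s\<in>{1..}. F s = k"
      by (rule has_field_derivative_zero_constant)
         (use F supp in \<open>auto intro: has_field_derivative_at_within\<close>, metis F has_field_derivative_at_within)
    with that show ?thesis by force
  qed
  ultimately show ?thesis
    using that[of "\<lambda>s. F s - F 1"] by blast
qed

text \<open>
  The left-hand side is constant in \<open>r\<close>. If \<open>G\<close> is the antiderivative of \<open>g\<close> with the same support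
  bound, then twice the \<open>r\<close>-derivative of the integrand equals the divergence of
  \<open>G (y \<bullet> y)\<close> times the gradient of \<open>U\<close> at \<open>c + r y\<close>, because the remaining term of that divergence
  is a multiple of the Laplacian. So the derivative of the integral vanishes.
\<close>

lemma harmonic_radial_mean:
  fixes U :: "'a::euclidean_space \<Rightarrow> real" and g :: "real \<Rightarrow> real"
  assumes harm: "harmonic_on (ball c R) U" and r: "0 \<le> r" "r < R"
    and contg: "continuous_on UNIV g" and suppg: "\<And>s. s \<ge> 1 \<Longrightarrow> g s = 0"
  shows "integral UNIV (\<lambda>y. g (y \<bullet> y) * U (c + r *\<^sub>R y)) = U c * integral UNIV (\<lambda>y::'a. g (y \<bullet> y))"
proof -
  obtain G where derG: "\<And>s. (G has_field_derivative g s) (at s)"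
    and suppG: "\<And>s. s \<ge> 1 \<Longrightarrow> G s = 0"
    using ex_compactly_supported_antiderivative[OF contg suppg] by blast
  have C2: "C2_on (ball c R) U" and lap: "\<And>x. x \<in> ball c R \<Longrightarrow> laplacian U x = 0"
    using harm by (auto simp: harmonic_on_def)
  have contG: "continuous_on UNIV G"
    using derG DERIV_continuous_on[of UNIV G g] by simp
  have contU: "continuous_on (ball c R) U"
    using C2 by (auto simp: C2_on_def intro!: continuous_at_imp_continuous_on differentiable_imp_continuous_within)
  have contP: "continuous_on (ball c R) (partial b U)" if "b \<in> Basis" for b
    using C2 that by (auto simp: C2_on_def intro!: continuous_at_imp_continuous_on differentiable_imp_continuous_within)
  have contPP: "continuous_on (ball c R) (partial b (partial b U))" if "b \<in> Basis" for b
    using C2 that by (auto simp: C2_on_def)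
  have inside: "c + t *\<^sub>R y \<in> ball c R" if "t \<in> {0..r}" "norm y \<le> 1" for t y
  proof -
    have "t * norm y \<le> r * 1"
      using that by (intro mult_mono) auto
    with r that show ?thesis by (simp add: dist_norm)
  qed
  have outside: "y \<bullet> y > 1" if "\<not> norm y \<le> 1" for y :: 'a
    using that by (simp add: norm_eq_sqrt_inner)
  have outside': "y \<bullet> y \<ge> 1" if "norm y \<ge> 1" for y :: 'a
    using that by (simp add: norm_eq_sqrt_inner)
  define F where "F t y = g (y \<bullet> y) * (\<Sum>b\<in>Basis. (y \<bullet> b) * partial b U (c + t *\<^sub>R y))" for t and y :: 'a
  have F_integral: "integral UNIV (F t) = 0" if t: "t \<in> {0..r}" for t
  proof -
    \<comment> \<open>\<open>D b\<close> is the derivative of \<open>H b\<close> in direction \<open>b\<close>, and the sum of all \<open>D b\<close> is \<open>2 * F t\<close>.\<close>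
    define H where "H b y = G (y \<bullet> y) * partial b U (c + t *\<^sub>R y)" for b y
    define D where "D b y = 2 * ((y \<bullet> b) * (g (y \<bullet> y) * partial b U (c + t *\<^sub>R y)))
        + t * (G (y \<bullet> y) * partial b (partial b U) (c + t *\<^sub>R y))" for b y
    have slice: "continuous_on UNIV (\<lambda>y. u (y \<bullet> y) * v (c + t *\<^sub>R y))"
      if "continuous_on UNIV u" "\<And>s. s \<ge> 1 \<Longrightarrow> u s = 0" "continuous_on (ball c R) v"
      for u and v :: "'a \<Rightarrow> real"
      using that r(2) t by (intro continuous_on_cutoff_slice)
    have contD: "continuous_on UNIV (D b)" if "b \<in> Basis" for b
      unfolding D_def
      by (intro continuous_on_add continuous_on_mult continuous_on_const continuous_on_inner
          continuous_on_id slice contg contG contP contPP suppg suppG that)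
    have D0: "D b y = 0" if "norm y \<ge> 1" for b y
      using outside'[OF that] by (simp add: D_def suppg suppG)
    have "integral UNIV (D b) = 0" if b: "b \<in> Basis" for b
    proof (rule integral_directional_derivative_eq_0[OF b, where H = "H b"])
      show "continuous_on UNIV (H b)"
        unfolding H_def by (intro slice contG contP suppG b)
      show "H b y = 0" if "norm y \<ge> 1" for y
        using outside'[OF that] by (simp add: H_def suppG)
      show "((\<lambda>s. H b (y + s *\<^sub>R b)) has_real_derivative D b y) (at 0)" for y
      proof (cases "norm y \<le> 1")
        case True
        have "((\<lambda>s. partial b U ((c + t *\<^sub>R y) + (t * s) *\<^sub>R b)) has_field_derivative
            t * partial b (partial b U) (c + t *\<^sub>R y)) (at 0)"
          using C2 inside[OF t True] b by (intro has_derivative_along_line) (auto simp: C2_on_def)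
        then have 1: "((\<lambda>s. partial b U (c + t *\<^sub>R (y + s *\<^sub>R b))) has_field_derivative
            t * partial b (partial b U) (c + t *\<^sub>R y)) (at 0)"
          by (simp add: algebra_simps)
        have "((\<lambda>s. y \<bullet> y + 2 * s * (y \<bullet> b) + s * s) has_real_derivative 2 * (y \<bullet> b)) (at 0)"
          by (auto intro!: derivative_eq_intros)
        moreover have "(y + s *\<^sub>R b) \<bullet> (y + s *\<^sub>R b) = y \<bullet> y + 2 * s * (y \<bullet> b) + s * s" for s
          using b by (simp add: inner_add_left inner_add_right inner_Basis inner_commute[of b y] algebra_simps)
        ultimately have "((\<lambda>s. (y + s *\<^sub>R b) \<bullet> (y + s *\<^sub>R b)) has_real_derivative 2 * (y \<bullet> b)) (at 0)"
          by simp
        then have 2: "((\<lambda>s. G ((y + s *\<^sub>R b) \<bullet> (y + s *\<^sub>R b))) has_real_derivative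
            g (y \<bullet> y) * (2 * (y \<bullet> b))) (at 0)"
          using DERIV_chain2[of G "g (y \<bullet> y)" "\<lambda>s. (y + s *\<^sub>R b) \<bullet> (y + s *\<^sub>R b)" 0] derG by simp
        show ?thesis
          unfolding H_def using DERIV_mult[OF 2 1] by (simp add: D_def algebra_simps)
      next
        case False
        have "open {s. 1 < (y + s *\<^sub>R b) \<bullet> (y + s *\<^sub>R b)}"
          by (intro open_Collect_less continuous_intros)
        moreover have "0 \<in> {s. 1 < (y + s *\<^sub>R b) \<bullet> (y + s *\<^sub>R b)}"
          using outside[OF False] by simp
        ultimately have "((\<lambda>s. H b (y + s *\<^sub>R b)) has_real_derivative 0) (at 0)"
          by (rule has_field_derivative_transform_within_open[OF DERIV_const[of 0]])
             (simp add: H_def suppG)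
        then show ?thesis
          using D0[of y b] False by simp
      qed
    qed (use contD[OF b] D0 in auto)
    moreover have "(\<Sum>b\<in>Basis. D b y) = 2 * F t y" for y
    proof -
      have "G (y \<bullet> y) * (\<Sum>b\<in>Basis. partial b (partial b U) (c + t *\<^sub>R y)) = 0"
        using lap[OF inside[OF t, of y]] outside[of y] suppG[of "y \<bullet> y"]
        by (cases "norm y \<le> 1") (auto simp: laplacian_def)
      moreover have "(\<Sum>b\<in>Basis. D b y) = 2 * F t y
          + t * (G (y \<bullet> y) * (\<Sum>b\<in>Basis. partial b (partial b U) (c + t *\<^sub>R y)))"
        unfolding D_def F_def sum.distrib sum_distrib_left
        by (intro arg_cong2[where f = "(+)"] sum.cong) (auto simp: algebra_simps)
      ultimately show ?thesis
        by simp
    qed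
    moreover have "D b integrable_on UNIV" if "b \<in> Basis" for b
    proof -
      have "D b integrable_on cbox (- (1 *\<^sub>R One)) (1 *\<^sub>R One)"
        by (rule integrable_continuous[OF continuous_on_subset[OF contD[OF that]]]) simp
      moreover have "D b y = 0" if "y \<notin> cbox (- (1 *\<^sub>R One)) (1 *\<^sub>R One)" for y
        using D0 unit_ball_subset_cube[of y 1] that by force
      ultimately show ?thesis
        using integrable_on_superset by blast
    qed
    ultimately have "integral UNIV (\<lambda>y. 2 * F t y) = 0"
      using integral_sum[of Basis D UNIV] by simp
    then show ?thesis by simp
  qed
  define Q :: "'a set" where "Q = cbox (- (1 *\<^sub>R One)) (1 *\<^sub>R One)"
  have Q: "integral Q (\<lambda>y. g (y \<bullet> y) * u y) = integral UNIV (\<lambda>y. g (y \<bullet> y) * u y)" for u :: "'a \<Rightarrow> real"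
  proof (rule integral_eq_integral_UNIV_if_supported)
    fix y assume "y \<notin> Q"
    then have "norm y \<ge> 1"
      using unit_ball_subset_cube[of y 1] by (force simp: Q_def)
    then show "g (y \<bullet> y) * u y = 0" by (simp add: outside' suppg)
  qed
  have "((\<lambda>t. integral Q (\<lambda>y. g (y \<bullet> y) * U (c + t *\<^sub>R y))) has_field_derivative 0) (at t within {0..r})"
    if t: "t \<in> {0..r}" for t
  proof -
    have "((\<lambda>t. integral Q (\<lambda>y. g (y \<bullet> y) * U (c + t *\<^sub>R y))) has_field_derivative
      integral Q (F t)) (at t within {0..r})"
      unfolding Q_def
    proof (rule leibniz_rule_field_derivative)
      show "((\<lambda>t. g (y \<bullet> y) * U (c + t *\<^sub>R y)) has_real_derivative F t y) (at t within {0..r})"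
        if t: "t \<in> {0..r}" for t y
      proof (cases "norm y \<le> 1")
        case True
        have "((\<lambda>t. c + t *\<^sub>R y) has_derivative (\<lambda>t. t *\<^sub>R y)) (at t within {0..r})"
          by (auto intro!: derivative_eq_intros)
        from has_derivative_compose[OF this C2_on_has_derivative[OF C2 inside[OF t True]]]
        have "((\<lambda>t. U (c + t *\<^sub>R y)) has_field_derivative
            (\<Sum>b\<in>Basis. (y \<bullet> b) * partial b U (c + t *\<^sub>R y))) (at t within {0..r})"
          unfolding has_field_derivative_def
          by (rule has_derivative_eq_rhs) (simp add: fun_eq_iff sum_distrib_left sum_distrib_right ac_simps)
        then show ?thesis
          unfolding F_def by (rule DERIV_cmult)
      next
        case False
        then show ?thesis
          using outside[OF False] by (simp add: F_def suppg)
      qed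
      have cont: "continuous_on ({0..r} \<times> UNIV) (\<lambda>p. g (snd p \<bullet> snd p) * v (c + fst p *\<^sub>R snd p))"
        if "continuous_on (ball c R) v" for v
        by (rule continuous_on_cutoff[OF that contg suppg r(2)])
      show "(\<lambda>y. g (y \<bullet> y) * U (c + t *\<^sub>R y)) integrable_on cbox (- (1 *\<^sub>R One)) (1 *\<^sub>R One)"
        if t: "t \<in> {0..r}" for t
        by (intro integrable_continuous continuous_on_subset[OF continuous_on_cutoff_slice[OF contU contg suppg r(2) t]]) auto
      have "continuous_on ({0..r} \<times> UNIV) (\<lambda>p. \<Sum>b\<in>Basis. (snd p \<bullet> b) *
          (g (snd p \<bullet> snd p) * partial b U (c + fst p *\<^sub>R snd p)))"
        by (intro continuous_intros cont contP)
      then show "continuous_on ({0..r} \<times> cbox (- (1 *\<^sub>R One)) (1 *\<^sub>R One)) (\<lambda>(t, y). F t y)"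
        by (rule continuous_on_subset[OF continuous_on_eq])
           (auto simp: F_def sum_distrib_left algebra_simps)
    qed (use t in auto)
    moreover have "integral Q (F t) = 0"
      using Q F_integral[OF t] unfolding F_def[abs_def] by simp
    ultimately show ?thesis by simp
  qed
  then obtain k where k: "\<And>t. t \<in> {0..r} \<Longrightarrow> integral Q (\<lambda>y. g (y \<bullet> y) * U (c + t *\<^sub>R y)) = k"
    using has_field_derivative_zero_constant[of "{0..r}" "\<lambda>t. integral Q (\<lambda>y. g (y \<bullet> y) * U (c + t *\<^sub>R y))"]
    by auto
  have "integral UNIV (\<lambda>y. g (y \<bullet> y) * U (c + r *\<^sub>R y)) = integral Q (\<lambda>y. g (y \<bullet> y) * U (c + 0 *\<^sub>R y))"
    using k[of r] k[of 0] r Q by simp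
  also have "\<dots> = U c * integral UNIV (\<lambda>y::'a. g (y \<bullet> y))"
    using Q[of "\<lambda>_. U c"] by (simp add: mult.commute)
  finally show ?thesis .
qed

text \<open>
  Radial means for continuous weights that increase to the indicator of the unit ball converge, by
  dominated convergence, to the mean over the ball; scaling then replaces the unit ball by
  \<open>ball c r\<close>.
\<close>

lemma harmonic_ball_mean:
  fixes U :: "'a::euclidean_space \<Rightarrow> real"
  assumes harm: "harmonic_on (ball c R) U" and r: "0 < r" "r < R"
  shows "(U has_integral measure lborel (ball c r) * U c) (ball c r)"
proof -
  have contU: "continuous_on (ball c R) U"
    using harm by (auto simp: harmonic_on_def C2_on_def
        intro!: continuous_at_imp_continuous_on differentiable_imp_continuous_within)
  define g :: "nat \<Rightarrow> real \<Rightarrow> real" where "g k s = 1 - (min 1 (max 0 s)) ^ Suc k" for k s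
  have contg: "continuous_on UNIV (g k)" for k
    unfolding g_def by (intro continuous_intros)
  have suppg: "g k s = 0" if "s \<ge> 1" for k s
    using that by (simp add: g_def)
  have g01: "0 \<le> g k s" "g k s \<le> 1" for k s
    unfolding g_def using power_le_one[of "min 1 (max 0 s)" "Suc k"] by auto
  have lim: "(\<lambda>y. u (c + r *\<^sub>R y)) integrable_on ball 0 1 \<and>
      (\<lambda>k. integral UNIV (\<lambda>y. g k (y \<bullet> y) * u (c + r *\<^sub>R y)))
        \<longlonglongrightarrow> integral (ball 0 1) (\<lambda>y. u (c + r *\<^sub>R y))"
    if u: "continuous_on (ball c R) u" for u :: "'a \<Rightarrow> real"
  proof -
    let ?f = "\<lambda>k y. g k (y \<bullet> y) * u (c + r *\<^sub>R y)"
    have zero: "?f k y = 0" if "y \<notin> ball 0 1" for k y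
      using that by (simp add: suppg norm_eq_sqrt_inner)
    have eq: "integral (ball 0 1) (?f k) = integral UNIV (?f k)" for k
      by (rule integral_eq_integral_UNIV_if_supported[OF zero])
    have "?f k integrable_on ball 0 1" for k
    proof -
      have "?f k integrable_on cbox (- (1 *\<^sub>R One)) (1 *\<^sub>R One)"
        using r by (intro integrable_continuous continuous_on_subset[OF
              continuous_on_cutoff_slice[OF u contg suppg r(2)]]) auto
      moreover have "(\<lambda>y. if y \<in> ball 0 1 then ?f k y else 0) = ?f k"
        using zero by auto
      ultimately have "(\<lambda>y. if y \<in> ball 0 1 then ?f k y else 0) integrable_on cbox (- (1 *\<^sub>R One)) (1 *\<^sub>R One)"
        by simp
      moreover have "ball 0 1 \<subseteq> cbox (- (1 *\<^sub>R One)) (1 *\<^sub>R One :: 'a)"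
        using unit_ball_subset_cube[of _ 1] by auto
      ultimately show ?thesis
        unfolding integrable_on_def by (simp only: has_integral_restrict)
    qed
    moreover obtain B where B: "\<And>x. x \<in> cball c r \<Longrightarrow> \<bar>u x\<bar> \<le> B"
    proof -
      have "cball c r \<subseteq> ball c R"
        using r by auto
      then have "compact (u ` cball c r)"
        using u by (intro compact_continuous_image continuous_on_subset[OF u]) auto
      then show ?thesis
        using that compact_imp_bounded[of "u ` cball c r"] by (force simp: bounded_iff)
    qed
    moreover have "\<bar>?f k y\<bar> \<le> B" if "y \<in> ball 0 1" for k y
    proof -
      have "c + r *\<^sub>R y \<in> cball c r"
        using that r by (simp add: dist_norm mult_le_cancel_left2)
      then show ?thesis
        using B[of "c + r *\<^sub>R y"] g01[of k "y \<bullet> y"]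
          mult_mono[of "\<bar>g k (y \<bullet> y)\<bar>" 1 "\<bar>u (c + r *\<^sub>R y)\<bar>" B] by (simp add: abs_mult)
    qed
    moreover have "(\<lambda>k. ?f k y) \<longlonglongrightarrow> u (c + r *\<^sub>R y)" if "y \<in> ball 0 1" for y
    proof -
      have "y \<bullet> y < 1"
        using that by (simp add: norm_eq_sqrt_inner)
      then have "(\<lambda>k. (y \<bullet> y) ^ Suc k) \<longlonglongrightarrow> 0"
        by (intro LIMSEQ_Suc LIMSEQ_power_zero) auto
      then have "(\<lambda>k. (1 - (y \<bullet> y) ^ Suc k) * u (c + r *\<^sub>R y)) \<longlonglongrightarrow> (1 - 0) * u (c + r *\<^sub>R y)"
        by (intro tendsto_intros)
      then show ?thesis
        using \<open>y \<bullet> y < 1\<close> by (simp add: g_def)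
    qed
    moreover have "(\<lambda>_. B) integrable_on ball (0::'a) 1"
      by (rule integrable_on_const) simp
    ultimately show ?thesis
      using dominated_convergence[of ?f "ball 0 1" "\<lambda>_. B" "\<lambda>y. u (c + r *\<^sub>R y)"] by (simp add: eq)
  qed
  have "(\<lambda>k. U c * integral UNIV (\<lambda>y::'a. g k (y \<bullet> y))) \<longlonglongrightarrow> U c * measure lborel (ball (0::'a) 1)"
  proof -
    have "integral (ball (0::'a) 1) (\<lambda>_. 1) = measure lborel (ball (0::'a) 1)"
      by (intro integral_unique has_integral_measure_lborel emeasure_lborel_ball_finite) simp
    then show ?thesis
      using lim[of "\<lambda>_. 1"] by (intro tendsto_intros) simp
  qed
  moreover have "(\<lambda>k. U c * integral UNIV (\<lambda>y::'a. g k (y \<bullet> y)))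
      \<longlonglongrightarrow> integral (ball 0 1) (\<lambda>y. U (c + r *\<^sub>R y))"
    using lim[OF contU] harmonic_radial_mean[OF harm _ r(2) contg suppg] r by simp
  ultimately have "integral (ball 0 1) (\<lambda>y. U (c + r *\<^sub>R y)) = U c * measure lborel (ball (0::'a) 1)"
    by (rule LIMSEQ_unique[symmetric])
  then have "((\<lambda>y. U (c + r *\<^sub>R y)) has_integral U c * measure lborel (ball (0::'a) 1)) (ball 0 1)"
    using lim[OF contU] by (simp add: has_integral_integral)
  moreover define Q :: "'a set" where "Q = cbox (- (1 *\<^sub>R One)) (1 *\<^sub>R One)"
  moreover have Q: "ball 0 1 \<subseteq> Q"
    using unit_ball_subset_cube[of _ 1] by (auto simp: Q_def)
  ultimately have "((\<lambda>y. if y \<in> ball 0 1 then U (c + r *\<^sub>R y) else 0) has_integral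
      U c * measure lborel (ball (0::'a) 1)) Q"
    by (simp only: has_integral_restrict)
  from has_integral_affinity[OF this[unfolded Q_def], of "1 / r" "- (1 / r) *\<^sub>R c"]
  have "((\<lambda>x. if (1 / r) *\<^sub>R x + - (1 / r) *\<^sub>R c \<in> ball 0 1 then
          U (c + r *\<^sub>R ((1 / r) *\<^sub>R x + - (1 / r) *\<^sub>R c)) else 0) has_integral
      (1 / \<bar>1 / r\<bar> ^ DIM('a)) *\<^sub>R (U c * measure lborel (ball (0::'a) 1))) ((\<lambda>x. r *\<^sub>R x + c) ` Q)"
    using r by (simp add: Q_def)
  moreover have "(1 / r) *\<^sub>R x + - (1 / r) *\<^sub>R c \<in> ball 0 1 \<longleftrightarrow> x \<in> ball c r" for x
  proof -
    have "(1 / r) *\<^sub>R x + - (1 / r) *\<^sub>R c = (1 / r) *\<^sub>R (x - c)"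
      by (simp add: algebra_simps)
    then show ?thesis
      using r by (simp add: dist_norm norm_minus_commute)
  qed
  moreover have "c + r *\<^sub>R ((1 / r) *\<^sub>R x + - (1 / r) *\<^sub>R c) = x" for x
    using r by (simp add: algebra_simps)
  moreover have "(1 / \<bar>1 / r\<bar> ^ DIM('a)) *\<^sub>R (U c * measure lborel (ball (0::'a) 1)) = measure lborel (ball c r) * U c"
    using r by (simp add: content_ball_conv_unit_ball[of r c] power_divide)
  ultimately have "((\<lambda>x. if x \<in> ball c r then U x else 0) has_integral measure lborel (ball c r) * U c)
      ((\<lambda>x. r *\<^sub>R x + c) ` Q)"
    by (simp only:)
  moreover have "ball c r \<subseteq> (\<lambda>x. r *\<^sub>R x + c) ` Q"
  proof
    fix x assume "x \<in> ball c r"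
    then have "(1 / r) *\<^sub>R (x - c) \<in> Q"
      using r Q by (intro subsetD[OF Q]) (simp add: dist_norm norm_minus_commute)
    then show "x \<in> (\<lambda>x. r *\<^sub>R x + c) ` Q"
      using r by (intro image_eqI[of _ _ "(1 / r) *\<^sub>R (x - c)"]) auto
  qed
  ultimately show ?thesis
    by (simp only: has_integral_restrict)
qed

section \<open>Harnack's inequality with the sharp exponent\<close>

lemma power_Suc_diff_le:
  fixes a b :: real
  assumes "0 \<le> b" "b \<le> a"
  shows "a ^ Suc k - b ^ Suc k \<le> real (Suc k) * (a - b) * a ^ k"
proof (induction k)
  case (Suc k)
  have "a ^ Suc (Suc k) - b ^ Suc (Suc k) = a * (a ^ Suc k - b ^ Suc k) + (a - b) * b ^ Suc k"
    by (simp add: algebra_simps)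
  also have "\<dots> \<le> a * (real (Suc k) * (a - b) * a ^ k) + (a - b) * a ^ Suc k"
    using assms by (intro add_mono mult_left_mono Suc.IH power_mono) auto
  finally show ?case
    by (simp add: algebra_simps)
qed simp

lemma harmonic_on_subset:
  "harmonic_on S U \<Longrightarrow> T \<subseteq> S \<Longrightarrow> harmonic_on T U"
  unfolding harmonic_on_def C2_on_def by (blast intro: continuous_on_subset)

text \<open>
  Apply the mean value property to the nonnegative function \<open>a - U\<close>. With \<open>\<eta>\<close> half the distance
  from \<open>x\<close> to the sphere of radius \<open>R\<close>, the ball of radius \<open>\<eta>\<close> around \<open>x\<close> lies in the shell of
  thickness at most \<open>2 \<eta>\<close> between the balls of radius \<open>s - \<eta>\<close> and \<open>s + \<eta>\<close> around \<open>c\<close>. The volume of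
  the shell is of order \<open>\<eta> R ^ n\<close>, that of the small ball of order \<open>\<eta> ^ (n + 1)\<close>; their quotient
  \<open>(R / \<eta>) ^ n\<close> has the exponent \<open>n\<close>, whereas comparing with the full ball around \<open>c\<close> would give
  \<open>n + 1\<close>.
\<close>

lemma harmonic_harnack:
  fixes U :: "'a::euclidean_space \<Rightarrow> real"
  assumes harm: "harmonic_on (ball c R) U" and le: "\<And>z. z \<in> ball c R \<Longrightarrow> U z \<le> a"
    and x: "dist c x < R" and dim: "DIM('a) = n + 1"
  shows "a - U x \<le> 2 * (real n + 1) * (2 * R / (R - dist c x)) ^ n * (a - U c)"
proof -
  define s where "s = dist c x"
  define \<eta> where "\<eta> = (R - s) / 2"
  define r1 where "r1 = s + \<eta>"
  \<comment> \<open>If \<open>x\<close> is closer than \<open>\<eta>\<close> to \<open>c\<close>, the inner ball is empty and the shell is a ball.\<close>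
  define r2 where "r2 = max 0 (s - \<eta>)"
  define v where "v = unit_ball_vol (real (n + 1))"
  have s: "0 \<le> s" "s < R"
    using x by (auto simp: s_def)
  have \<eta>: "0 < \<eta>" "s + 2 * \<eta> = R"
    using s by (auto simp: \<eta>_def field_simps)
  have v: "v > 0"
    unfolding v_def by simp
  have r: "0 \<le> r2" "r2 < r1" "r1 < R" "r1 - r2 \<le> 2 * \<eta>" "0 < r1"
    using s \<eta> by (auto simp: r1_def r2_def)
  have int: "((\<lambda>y. a - U y) has_integral v * r ^ (n + 1) * (a - U b)) (ball b r)"
    if "0 \<le> r" "r < R'" "ball b R' \<subseteq> ball c R" for b r R'
  proof (cases "r = 0")
    case False
    have vol: "measure lborel (ball b r) = v * r ^ (n + 1)"
      using that content_ball[of r b] dim by (simp add: v_def)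
    have const: "((\<lambda>y. 1 * a) has_integral measure lborel (ball b r) * a) (ball b r)"
      by (intro has_integral_mult_left has_integral_measure_lborel emeasure_lborel_ball_finite) simp
    have "(U has_integral measure lborel (ball b r) * U b) (ball b r)"
      using that False by (intro harmonic_ball_mean[OF harmonic_on_subset[OF harm that(3)]]) auto
    from has_integral_diff[OF const this] show ?thesis
      by (simp only: vol mult_1 right_diff_distrib)
  next
    case True
    then show ?thesis by simp
  qed
  have sub: "ball x (2 * \<eta>) \<subseteq> ball c R"
  proof
    fix y assume "y \<in> ball x (2 * \<eta>)"
    then show "y \<in> ball c R"
      using \<eta> dist_triangle[of c y x] by (simp add: s_def)
  qed
  have ineqs: "dist c y \<le> s + dist x y" "s \<le> dist c y + dist x y" for y
    using dist_triangle[of c y x] dist_triangle[of c x y] by (auto simp: s_def dist_commute)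
  have un: "((\<lambda>y. a - U y) has_integral v * \<eta> ^ (n + 1) * (a - U x) + v * r2 ^ (n + 1) * (a - U c))
      (ball x \<eta> \<union> ball c r2)"
  proof (rule has_integral_Un)
    show "((\<lambda>y. a - U y) has_integral v * \<eta> ^ (n + 1) * (a - U x)) (ball x \<eta>)"
      using \<eta> by (intro int[OF _ _ sub]) auto
    show "((\<lambda>y. a - U y) has_integral v * r2 ^ (n + 1) * (a - U c)) (ball c r2)"
      using r by (intro int[of _ R]) auto
    have False if "y \<in> ball x \<eta>" "y \<in> ball c r2" for y
      using that ineqs(2)[of y] by (auto simp: r2_def less_max_iff_disj)
    then have "ball x \<eta> \<inter> ball c r2 = {}"
      by blast
    then show "negligible (ball x \<eta> \<inter> ball c r2)" by simp
  qed
  have "ball x \<eta> \<subseteq> ball c r1"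
  proof
    fix y assume "y \<in> ball x \<eta>"
    then show "y \<in> ball c r1"
      using ineqs(1)[of y] by (simp add: r1_def)
  qed
  then have sub1: "ball x \<eta> \<union> ball c r2 \<subseteq> ball c r1"
    using r by (auto dest: less_trans)
  have "((\<lambda>y. a - U y) has_integral v * r1 ^ (n + 1) * (a - U c)) (ball c r1)"
    using r by (intro int[of _ R]) auto
  then have "v * \<eta> ^ (n + 1) * (a - U x) + v * r2 ^ (n + 1) * (a - U c) \<le> v * r1 ^ (n + 1) * (a - U c)"
  proof (rule has_integral_subset_le[OF sub1 un])
    show "\<forall>y\<in>ball c r1. 0 \<le> a - U y"
      using le r by fastforce
  qed
  then have "v * (\<eta> ^ (n + 1) * (a - U x)) \<le> v * ((r1 ^ (n + 1) - r2 ^ (n + 1)) * (a - U c))"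
    by (simp add: algebra_simps)
  then have "\<eta> ^ (n + 1) * (a - U x) \<le> (r1 ^ (n + 1) - r2 ^ (n + 1)) * (a - U c)"
    using v by simp
  also have "\<dots> \<le> (real (n + 1) * (2 * \<eta>) * R ^ n) * (a - U c)"
  proof (rule mult_right_mono)
    have "r1 ^ Suc n - r2 ^ Suc n \<le> real (Suc n) * (r1 - r2) * r1 ^ n"
      using r by (intro power_Suc_diff_le) auto
    also have "\<dots> \<le> real (Suc n) * (2 * \<eta>) * R ^ n"
      using r by (intro mult_mono power_mono) auto
    finally show "r1 ^ (n + 1) - r2 ^ (n + 1) \<le> real (n + 1) * (2 * \<eta>) * R ^ n" by simp
    show "0 \<le> a - U c" using le[of c] s by simp
  qed
  finally have "\<eta> * (\<eta> ^ n * (a - U x)) \<le> \<eta> * (2 * (real n + 1) * R ^ n * (a - U c))"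
    by (simp add: algebra_simps)
  then have "\<eta> ^ n * (a - U x) \<le> 2 * (real n + 1) * R ^ n * (a - U c)"
    using \<eta> by simp
  then have "a - U x \<le> 2 * (real n + 1) * (R / \<eta>) ^ n * (a - U c)"
    using \<eta> by (simp add: power_divide field_simps)
  also have "R / \<eta> = 2 * R / (R - dist c x)"
    by (simp add: \<eta>_def s_def)
  finally show ?thesis .
qed

section \<open>Decay of the weight at its own scale\<close>

lemma C2_on_real_DERIV:
  fixes w :: "real \<Rightarrow> real"
  assumes C2: "C2_on S w" and S: "open S" and y: "y \<in> S"
  shows "(w has_field_derivative deriv w y) (at y)" "deriv w differentiable (at y)"
proof -
  have d: "(w has_field_derivative deriv w x) (at x)" if "x \<in> S" for x
    using C2 that by (auto simp: C2_on_def real_differentiable_def DERIV_imp_deriv)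
  then show "(w has_field_derivative deriv w y) (at y)" using y .
  have p: "partial 1 w x = deriv w x" if "x \<in> S" for x
    using frechet_derivative_at[OF d[OF that, unfolded has_field_derivative_def]]
    by (simp add: partial_def fun_eq_iff) (metis mult.right_neutral)
  have "partial 1 w differentiable (at y)"
    using C2 y by (simp add: C2_on_def)
  then show "deriv w differentiable (at y)"
    using p S y unfolding differentiable_def
    by (blast intro: has_derivative_transform_within_open)
qed

text \<open>
  Here \<open>q\<close> stands for \<open>- w / w'\<close>. The slope bound gives \<open>q \<le> q y + \<kappa> (t - y)\<close> to the right of \<open>y\<close>, so
  \<open>(ln w)' = - 1 / q\<close> integrates to a power decay with exponent \<open>1 / \<kappa>\<close>. To the left of \<open>y\<close> the
  same bound keeps \<open>q\<close> above \<open>q y / 2\<close> on an interval of length \<open>h = q y / (2 \<kappa>)\<close>, so moving left by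
  \<open>h\<close> increases \<open>w\<close> at most by the factor \<open>exp (1 / \<kappa>)\<close>. Since \<open>q\<close> may drop steeply, there is no
  upper bound for \<open>q\<close> to the left of \<open>y\<close>; this is why both estimates are based at \<open>y\<close> and joined
  there.
\<close>

lemma weight_decay:
  fixes w :: "real \<Rightarrow> real" and q q' :: "real \<Rightarrow> real"
  assumes pos: "\<And>y. 0 < y \<Longrightarrow> w y > 0"
    and anti: "\<And>x y. 0 < x \<Longrightarrow> x \<le> y \<Longrightarrow> w y \<le> w x"
    and q0: "\<And>y. 0 < y \<Longrightarrow> y < 1 \<Longrightarrow> q y > 0"
    and w': "\<And>y. 0 < y \<Longrightarrow> y < 1 \<Longrightarrow> (w has_field_derivative - w y / q y) (at y)"
    and q': "\<And>y. 0 < y \<Longrightarrow> y < 1 \<Longrightarrow> (q has_field_derivative q' y) (at y)"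
    and q'le: "\<And>y. 0 < y \<Longrightarrow> y < 1 \<Longrightarrow> q' y \<le> \<kappa>"
    and lim: "(q \<longlongrightarrow> 0) (at_right 0)"
  shows "\<kappa> > 0"
    and "0 < y \<Longrightarrow> y < 1 \<Longrightarrow> \<exists>h. 0 < h \<and> h \<le> y / 2 \<and> (\<forall>t. 0 < t \<longrightarrow> y - h + t < 1 \<longrightarrow>
      w (y - h + t) \<le> exp (1 / \<kappa>) * (t / (2 * h)) powr (- 1 / \<kappa>) * w y)"
proof -
  have inc: "q y - q x \<le> \<kappa> * (y - x)" if "0 < x" "x \<le> y" "y < 1" for x y
  proof -
    have "\<kappa> * x - q x \<le> \<kappa> * y - q y"
    proof (rule DERIV_nonneg_imp_nondecreasing[OF \<open>x \<le> y\<close>, of "\<lambda>t. \<kappa> * t - q t"])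
      fix t assume "x \<le> t" "t \<le> y"
      then show "\<exists>d. ((\<lambda>t. \<kappa> * t - q t) has_real_derivative d) (at t) \<and> 0 \<le> d"
        using that q'[of t] q'le[of t]
        by (intro exI[of _ "\<kappa> - q' t"]) (auto intro!: derivative_eq_intros)
    qed
    then show ?thesis by (simp add: algebra_simps)
  qed
  \<comment> \<open>Let the left end point in \<open>inc\<close> tend to 0.\<close>
  have qle: "q y \<le> \<kappa> * y" if "0 < y" "y < 1" for y
  proof -
    have "((\<lambda>x. q x + \<kappa> * (y - x)) \<longlongrightarrow> 0 + \<kappa> * (y - 0)) (at_right 0)"
      by (intro tendsto_intros lim)
    moreover have "\<forall>\<^sub>F x in at_right 0. q y \<le> q x + \<kappa> * (y - x)"
      using eventually_at_right_real[OF \<open>0 < y\<close>]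
      by eventually_elim (use inc[of _ y] that in force)
    ultimately have "q y \<le> 0 + \<kappa> * (y - 0)"
      by (rule tendsto_lowerbound) simp
    then show ?thesis by simp
  qed
  show \<kappa>: "\<kappa> > 0"
    using qle[of "1/2"] q0[of "1/2"] by simp
  have ln': "((\<lambda>t. ln (w t)) has_field_derivative - 1 / q t) (at t)" if "0 < t" "t < 1" for t
    using w'[OF that] pos[of t] that by (auto intro!: derivative_eq_intros simp: field_simps)
  assume y: "0 < y" "y < 1"
  define h where "h = q y / (2 * \<kappa>)"
  have h: "0 < h" "h \<le> y / 2"
    using q0[OF y] qle[OF y] \<kappa> by (auto simp: h_def field_simps)
  have "ln (w (y - h)) + 2 / q y * (y - h) \<le> ln (w y) + 2 / q y * y"
  proof (rule DERIV_nonneg_imp_nondecreasing[of "y - h" y "\<lambda>t. ln (w t) + 2 / q y * t"])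
    fix t assume t: "y - h \<le> t" "t \<le> y"
    then have t0: "0 < t" "t < 1" using h y by auto
    have "q y - q t \<le> \<kappa> * (y - t)"
      using inc t0 t y by simp
    also have "\<dots> \<le> \<kappa> * h"
      using \<kappa> t by simp
    finally have "q y / 2 \<le> q t"
      using \<kappa> by (simp add: h_def)
    then have "1 / q t \<le> 2 / q y"
      using q0[OF y] q0[OF t0] by (simp add: field_simps)
    then show "\<exists>d. ((\<lambda>t. ln (w t) + 2 / q y * t) has_real_derivative d) (at t) \<and> 0 \<le> d"
      using DERIV_add[OF ln'[OF t0] DERIV_cmult[OF DERIV_ident, of "2 / q y"]]
      by (intro exI[of _ "- 1 / q t + 2 / q y"]) auto
  qed (use h in auto)
  moreover have "2 / q y * y - 2 / q y * (y - h) = 1 / \<kappa>"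
    using q0[OF y] \<kappa> by (simp add: h_def field_simps)
  ultimately have "ln (w (y - h)) \<le> ln (exp (1 / \<kappa>) * w y)"
    using pos[of y] y by (simp add: ln_mult)
  then have near: "w (y - h) \<le> exp (1 / \<kappa>) * w y"
    using pos[of y] pos[of "y - h"] y h by (subst (asm) ln_le_cancel_iff) auto
  have far: "w (y + s) \<le> (1 + \<kappa> * s / q y) powr (- 1 / \<kappa>) * w y" if s: "0 \<le> s" "y + s < 1" for s
  proof -
    have "ln (w (y + s)) + 1 / \<kappa> * ln (1 + \<kappa> * (y + s - y) / q y) \<le> ln (w y) + 1 / \<kappa> * ln (1 + \<kappa> * (y - y) / q y)"
    proof (rule DERIV_nonpos_imp_nonincreasing[of y "y + s" "\<lambda>t. ln (w t) + 1 / \<kappa> * ln (1 + \<kappa> * (t - y) / q y)"])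
      fix t assume t: "y \<le> t" "t \<le> y + s"
      then have t0: "0 < t" "t < 1" using s y by auto
      have p: "0 < 1 + \<kappa> * (t - y) / q y"
        using q0[OF y] \<kappa> t by (intro add_pos_nonneg) auto
      have p2: "0 < q y + \<kappa> * (t - y)"
        using q0[OF y] \<kappa> t by (intro add_pos_nonneg) auto
      have "q t \<le> q y + \<kappa> * (t - y)"
        using inc[of y t] t t0 y by simp
      then have "1 / (q y + \<kappa> * (t - y)) \<le> 1 / q t"
        using q0[OF t0] by (simp add: frac_le)
      moreover have "((\<lambda>t. ln (1 + \<kappa> * (t - y) / q y)) has_real_derivative
          (\<kappa> / q y) / (1 + \<kappa> * (t - y) / q y)) (at t)"
        using p q0[OF y] by (auto intro!: derivative_eq_intros)
      moreover have "1 / \<kappa> * ((\<kappa> / q y) / (1 + \<kappa> * (t - y) / q y)) = 1 / (q y + \<kappa> * (t - y))"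
      proof -
        have "1 + \<kappa> * (t - y) / q y = (q y + \<kappa> * (t - y)) / q y"
          using q0[OF y] by (simp add: field_simps)
        then show ?thesis using q0[OF y] \<kappa> p2 by simp
      qed
      ultimately have "((\<lambda>t. ln (w t) + 1 / \<kappa> * ln (1 + \<kappa> * (t - y) / q y)) has_real_derivative
          - 1 / q t + 1 / (q y + \<kappa> * (t - y))) (at t)" "- 1 / q t + 1 / (q y + \<kappa> * (t - y)) \<le> 0"
        using DERIV_add[OF ln'[OF t0] DERIV_cmult[of "\<lambda>t. ln (1 + \<kappa> * (t - y) / q y)"
              "(\<kappa> / q y) / (1 + \<kappa> * (t - y) / q y)" t UNIV "1 / \<kappa>"]] by simp_all
      then show "\<exists>d. ((\<lambda>t. ln (w t) + 1 / \<kappa> * ln (1 + \<kappa> * (t - y) / q y)) has_real_derivative d) (at t) \<and> d \<le> 0"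
        by blast
    qed (use s in auto)
    then have "ln (w (y + s)) \<le> ln ((1 + \<kappa> * s / q y) powr (- 1 / \<kappa>) * w y)"
    proof -
      have "0 < 1 + \<kappa> * s / q y"
        using q0[OF y] \<kappa> s by (intro add_pos_nonneg) auto
      then have "ln ((1 + \<kappa> * s / q y) powr (- 1 / \<kappa>) * w y) = - 1 / \<kappa> * ln (1 + \<kappa> * s / q y) + ln (w y)"
        using pos[of y] y by (subst ln_mult_pos) (auto simp: ln_powr)
      then show ?thesis
        using \<open>ln (w (y + s)) + _ \<le> _\<close> by simp
    qed
    moreover have "0 < (1 + \<kappa> * s / q y) powr (- 1 / \<kappa>) * w y"
    proof -
      have "0 < 1 + \<kappa> * s / q y"
        using q0[OF y] \<kappa> s by (intro add_pos_nonneg) auto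
      then show ?thesis using pos[of y] y by simp
    qed
    ultimately show ?thesis
      using pos[of "y + s"] y s by (subst (asm) ln_le_cancel_iff) auto
  qed
  have "w (y - h + t) \<le> exp (1 / \<kappa>) * (t / (2 * h)) powr (- 1 / \<kappa>) * w y"
    if t: "0 < t" "y - h + t < 1" for t
  proof (cases "t \<le> h")
    case True
    have "w (y - h + t) \<le> w (y - h)"
      using anti h y t by simp
    also note near
    also have "exp (1 / \<kappa>) * w y \<le> exp (1 / \<kappa>) * w y * (t / (2 * h)) powr (- 1 / \<kappa>)"
    proof -
      have "1 powr (- 1 / \<kappa>) \<le> (t / (2 * h)) powr (- 1 / \<kappa>)"
        using True h t \<kappa> by (intro powr_mono2') auto
      then show ?thesis
        using pos[of y] y by simp
    qed
    finally show ?thesis by (simp add: mult_ac)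
  next
    case False
    have "w (y - h + t) = w (y + (t - h))" by (simp add: algebra_simps)
    also have "\<dots> \<le> (1 + \<kappa> * (t - h) / q y) powr (- 1 / \<kappa>) * w y"
      using False t by (intro far) auto
    also have "1 + \<kappa> * (t - h) / q y = (h + t) / (2 * h)"
      using q0[OF y] \<kappa> by (simp add: h_def field_simps)
    also have "((h + t) / (2 * h)) powr (- 1 / \<kappa>) * w y \<le> (t / (2 * h)) powr (- 1 / \<kappa>) * w y"
      using h t \<kappa> pos[of y] y by (intro mult_right_mono powr_mono2') (auto simp: divide_right_mono)
    also have "\<dots> \<le> exp (1 / \<kappa>) * ((t / (2 * h)) powr (- 1 / \<kappa>) * w y)"
    proof -
      have "0 \<le> (t / (2 * h)) powr (- 1 / \<kappa>) * w y" using pos[of y] y by simp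
      moreover have "1 \<le> exp (1 / \<kappa>)" using \<kappa> by simp
      ultimately show ?thesis by (metis mult_right_mono mult_1)
    qed
    finally show ?thesis by (simp add: mult_ac)
  qed
  with h show "\<exists>h. 0 < h \<and> h \<le> y / 2 \<and> (\<forall>t. 0 < t \<longrightarrow> y - h + t < 1 \<longrightarrow>
      w (y - h + t) \<le> exp (1 / \<kappa>) * (t / (2 * h)) powr (- 1 / \<kappa>) * w y)"
    by blast
qed

section \<open>Propagation of a power majorant along a radius\<close>

text \<open>
  The points \<open>c\<close> and \<open>x\<close> lie on one radius, at distances \<open>t\<close> and \<open>t'\<close> from the sphere of radius
  \<open>1 - y0\<close>. The ball around \<open>c\<close> of radius \<open>(1 - \<rho> / 2) t\<close> contains \<open>x\<close> with margin at least \<open>\<rho> t / 2\<close>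
  and itself keeps the distance \<open>\<rho> t / 2\<close> from that sphere. So \<open>U\<close> is bounded there by the constant
  \<open>a\<close>, and Harnack's inequality applies with \<open>2 R / (R - dist c x) \<le> 4 / \<rho>\<close>.
\<close>

lemma harnack_step_on_ray:
  fixes U :: "'a::euclidean_space \<Rightarrow> real" and e :: 'a
  assumes dim: "DIM('a) = n + 1" and \<alpha>: "0 \<le> \<alpha>" and \<rho>: "0 < \<rho>" "\<rho> < 1"
    and harm: "harmonic_on (ball 0 1) U" and e: "norm e = 1" and A: "0 \<le> A" and y0: "0 \<le> y0"
    and bound: "\<And>z. norm z < 1 - y0 \<Longrightarrow> U z \<le> A * (1 - norm z - y0) powr (- \<alpha>)"
    and t: "0 < t" "t \<le> 1 - y0" and t': "\<rho> * t \<le> t'" "t' \<le> t"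
  shows "- U ((1 - y0 - t') *\<^sub>R e) \<le> 2 * (real n + 1) * (4 / \<rho>) ^ n *
    ((\<rho> / 2) powr (- \<alpha>) * A * t powr (- \<alpha>) - U ((1 - y0 - t) *\<^sub>R e))"
proof -
  define c where "c = (1 - y0 - t) *\<^sub>R e"
  define x where "x = (1 - y0 - t') *\<^sub>R e"
  define R where "R = (1 - \<rho> / 2) * t"
  define a where "a = (\<rho> / 2) powr (- \<alpha>) * A * t powr (- \<alpha>)"
  have norm_c: "norm c = 1 - y0 - t"
    using t e by (simp add: c_def)
  have "c - x = (t' - t) *\<^sub>R e"
    by (simp add: c_def x_def flip: scaleR_diff_left)
  then have dist: "dist c x = t - t'"
    using t' e by (simp add: dist_norm)
  have le_a: "norm z < 1 - y0" "U z \<le> a" if z: "z \<in> ball c R" for z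
  proof -
    have "norm z \<le> norm c + dist c z"
      using norm_triangle_ineq[of c "z - c"] by (simp add: dist_norm norm_minus_commute)
    with z have *: "1 - norm z - y0 > \<rho> / 2 * t"
      by (simp add: norm_c R_def algebra_simps)
    moreover have "0 < \<rho> / 2 * t"
      using \<rho> t by simp
    ultimately show less: "norm z < 1 - y0" by linarith
    have "U z \<le> A * (1 - norm z - y0) powr (- \<alpha>)"
      by (rule bound[OF less])
    also have "\<dots> \<le> A * (\<rho> / 2 * t) powr (- \<alpha>)"
      using * \<open>0 < \<rho> / 2 * t\<close> \<alpha> A by (intro mult_left_mono powr_mono2') auto
    also have "\<dots> = a"
      using powr_mult[of "\<rho> / 2" t "- \<alpha>"] \<rho> t by (simp add: a_def)
    finally show "U z \<le> a" .
  qed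
  have "ball c R \<subseteq> ball 0 1"
    using le_a(1) y0 by fastforce
  then have "harmonic_on (ball c R) U"
    by (rule harmonic_on_subset[OF harm])
  moreover have gap: "R - dist c x \<ge> \<rho> * t / 2"
    using t' by (simp add: dist R_def algebra_simps)
  moreover have "0 < \<rho> * t"
    using \<rho> t by simp
  ultimately have "a - U x \<le> 2 * (real n + 1) * (2 * R / (R - dist c x)) ^ n * (a - U c)"
    using le_a(2) dim by (intro harmonic_harnack) auto
  also have "\<dots> \<le> 2 * (real n + 1) * (4 / \<rho>) ^ n * (a - U c)"
  proof (intro mult_right_mono mult_left_mono power_mono)
    have "2 * R / (R - dist c x) \<le> 2 * t / (\<rho> * t / 2)"
      using gap \<open>0 < \<rho> * t\<close> \<rho> t by (intro frac_le) (auto simp: R_def)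
    also have "\<dots> = 4 / \<rho>"
      using t \<rho> by simp
    finally show "2 * R / (R - dist c x) \<le> 4 / \<rho>" .
    have "0 < R"
      using \<rho> t by (simp add: R_def)
    then show "0 \<le> 2 * R / (R - dist c x)" "0 \<le> a - U c"
      using le_a(2)[of c] gap \<open>0 < \<rho> * t\<close> by auto
  qed auto
  finally have "a - U x \<le> 2 * (real n + 1) * (4 / \<rho>) ^ n * (a - U c)" .
  moreover have "0 \<le> a"
    using A by (simp add: a_def)
  ultimately show ?thesis
    by (simp add: a_def c_def x_def)
qed

text \<open>
  The ratio of two consecutive scales is taken small enough that one Harnack step costs at most half of
  the growth allowed by the exponent \<open>\<alpha>\<close>.
\<close>

lemma ex_small_ratio:
  fixes C \<alpha> :: real
  assumes "\<alpha> > real n" "C > 1"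
  obtains \<rho> where "0 < \<rho>" "\<rho> < 1" "C * (1 / \<rho>) ^ n * \<rho> powr \<alpha> \<le> 1 / 2"
proof -
  define \<rho> where "\<rho> = (1 / (2 * C)) powr (1 / (\<alpha> - n))"
  have "0 < \<rho>"
    using assms by (simp add: \<rho>_def)
  moreover have "\<rho> < 1"
    using assms powr_less_mono2[of "1 / (\<alpha> - n)" "1 / (2 * C)" 1] by (simp add: \<rho>_def)
  moreover have "C * (1 / \<rho>) ^ n * \<rho> powr \<alpha> \<le> 1 / 2"
  proof -
    have "(1 / \<rho>) ^ n * \<rho> powr \<alpha> = \<rho> powr (\<alpha> - n)"
      using \<open>0 < \<rho>\<close> by (simp add: powr_diff powr_realpow power_one_over field_simps)
    also have "\<dots> = 1 / (2 * C)"
      using assms by (simp add: \<rho>_def powr_powr)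
    finally show ?thesis
      using assms by (simp add: mult.assoc)
  qed
  ultimately show ?thesis by (rule that)
qed

text \<open>
  Induction over the scales \<open>\<rho> ^ k * (1 - y0)\<close>, starting at the centre, where \<open>U\<close> vanishes. The
  constant \<open>K\<close> has to absorb two things: the first, incomplete step from the centre costs \<open>M * L\<close>,
  and each later step adds the majorant, of size \<open>L\<close>, to the bound that is already known, which is
  harmless because \<open>L \<le> K\<close> and the choice of \<open>\<rho>\<close> gives \<open>M * \<rho> powr \<alpha> \<le> 1 / 2\<close>.
\<close>

lemma power_growth_lower_bound:
  assumes dim: "DIM('a::euclidean_space) = n + 1" and \<alpha>: "\<alpha> > real n"
  shows "\<exists>K>0. \<forall>(U :: 'a \<Rightarrow> real) A y0 e t.
    harmonic_on (ball 0 1) U \<longrightarrow> U 0 = 0 \<longrightarrow> norm e = 1 \<longrightarrow> 0 \<le> A \<longrightarrow> 0 \<le> y0 \<longrightarrow>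
    (\<forall>z. norm z < 1 - y0 \<longrightarrow> U z \<le> A * (1 - norm z - y0) powr (- \<alpha>)) \<longrightarrow>
    0 < t \<longrightarrow> t \<le> 1 - y0 \<longrightarrow> - U ((1 - y0 - t) *\<^sub>R e) \<le> K * A * t powr (- \<alpha>)"
proof -
  define C where "C = 2 * (real n + 1) * (4::real) ^ n"
  have "C > 1"
    using one_le_power[of "4::real" n] mult_mono[of 2 "2 * (real n + 1)" 1 "4 ^ n"] by (simp add: C_def)
  then obtain \<rho> where \<rho>: "0 < \<rho>" "\<rho> < 1" and small: "C * (1 / \<rho>) ^ n * \<rho> powr \<alpha> \<le> 1 / 2"
    using ex_small_ratio[OF \<alpha>] by blast
  define M where "M = C * (1 / \<rho>) ^ n"
  define L where "L = (\<rho> / 2) powr (- \<alpha>)"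
  define K where "K = M * L + L"
  have pos: "0 < M" "0 < L" "0 < K" "L \<le> K" "M * L \<le> K"
    using \<open>C > 1\<close> \<rho> by (auto simp: M_def L_def K_def intro!: add_pos_pos mult_pos_pos)
  have "- U ((1 - y0 - t) *\<^sub>R e) \<le> K * A * t powr (- \<alpha>)"
    if U: "harmonic_on (ball 0 1) U" "U 0 = 0" and e: "norm e = 1" and A: "0 \<le> A" and y0: "0 \<le> y0"
      and bound: "\<forall>z. norm z < 1 - y0 \<longrightarrow> U z \<le> A * (1 - norm z - y0) powr (- \<alpha>)"
      and t: "0 < t" "t \<le> 1 - y0"
    for U :: "'a \<Rightarrow> real" and A y0 e t
  proof -
    have step: "- U ((1 - y0 - t') *\<^sub>R e) \<le> M * (L * A * s powr (- \<alpha>) - U ((1 - y0 - s) *\<^sub>R e))"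
      if "0 < s" "s \<le> 1 - y0" "\<rho> * s \<le> t'" "t' \<le> s" for s t'
      using harnack_step_on_ray[OF dim _ \<rho> U(1) e A y0 _ that] bound \<alpha>
      by (simp add: M_def C_def L_def power_divide)
    have "- U ((1 - y0 - t) *\<^sub>R e) \<le> K * A * t powr (- \<alpha>)"
      if "\<rho> ^ k * (1 - y0) \<le> t" "0 < t" "t \<le> 1 - y0" for k t
      using that
    proof (induction k arbitrary: t)
      case 0
      then have "t = 1 - y0" by simp
      then show ?case
        using U(2) pos A by simp
    next
      case (Suc k)
      show ?case
      proof (cases "\<rho> * (1 - y0) \<le> t")
        case True
        then have "- U ((1 - y0 - t) *\<^sub>R e) \<le> M * (L * A * (1 - y0) powr (- \<alpha>) - U 0)"
          using step[of "1 - y0" t] Suc.prems by simp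
        also have "\<dots> = (M * L) * A * (1 - y0) powr (- \<alpha>)"
          using U(2) by simp
        also have "\<dots> \<le> K * A * t powr (- \<alpha>)"
          using pos A Suc.prems \<alpha> by (intro mult_mono powr_mono2') auto
        finally show ?thesis .
      next
        case False
        define s where "s = t / \<rho>"
        have s: "0 < s" "s \<le> 1 - y0" "\<rho> * s = t" "t \<le> s" "\<rho> ^ k * (1 - y0) \<le> s"
          using False Suc.prems \<rho> by (auto simp: s_def field_simps intro: mult_left_le)
        have "- U ((1 - y0 - t) *\<^sub>R e) \<le> M * (L * A * s powr (- \<alpha>) - U ((1 - y0 - s) *\<^sub>R e))"
          using s by (intro step) auto
        also have "\<dots> \<le> M * (L * A * s powr (- \<alpha>) + K * A * s powr (- \<alpha>))"
          using Suc.IH[OF s(5,1,2)] pos by (intro mult_left_mono) auto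
        also have "\<dots> \<le> M * (K * A * s powr (- \<alpha>) + K * A * s powr (- \<alpha>))"
          using pos A by (intro mult_left_mono add_mono mult_right_mono) auto
        also have "s powr (- \<alpha>) = \<rho> powr \<alpha> * t powr (- \<alpha>)"
          using Suc.prems \<rho> by (simp add: s_def powr_divide powr_minus field_simps)
        also have "M * (K * A * (\<rho> powr \<alpha> * t powr (- \<alpha>)) + K * A * (\<rho> powr \<alpha> * t powr (- \<alpha>)))
            = (M * \<rho> powr \<alpha>) * (2 * (K * A * t powr (- \<alpha>)))"
          by (simp add: algebra_simps)
        also have "\<dots> \<le> 1 / 2 * (2 * (K * A * t powr (- \<alpha>)))"
          using small pos A by (intro mult_right_mono) (auto simp: M_def)
        finally show ?thesis by simp
      qed
    qed
    moreover obtain k where "\<rho> ^ k < t / (1 - y0)"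
      using real_arch_pow_inv[of "t / (1 - y0)" \<rho>] \<rho> t by auto
    then have "\<rho> ^ k * (1 - y0) \<le> t"
      using t by (simp add: field_simps)
    ultimately show ?thesis
      using t by blast
  qed
  with pos(3) show ?thesis by blast
qed

section \<open>The two-sided estimate\<close>

theorem theorem1:
  fixes n :: nat and \<delta> :: real
  assumes "n \<ge> 1" and "CARD('m::finite) = n + 1" and "\<delta> > 0"
  shows "\<exists>C::real. \<forall>(w :: real \<Rightarrow> real) (U :: real ^ 'm \<Rightarrow> real).
           (\<forall>y>0. w y > 0) \<longrightarrow>
           strict_antimono_on {0<..} w \<longrightarrow>
           C2_on {0<..} w \<longrightarrow>
           filterlim w at_top (at_right 0) \<longrightarrow>
           w 1 = 1 \<longrightarrow>
           (\<forall>y. 0 < y \<and> y < 1 \<longrightarrow> deriv w y \<noteq> 0) \<longrightarrow>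
           ((\<lambda>y. w y / deriv w y) \<longlongrightarrow> 0) (at_right 0) \<longrightarrow>
           (\<forall>y. 0 < y \<and> y < 1 \<longrightarrow> deriv (\<lambda>t. w t / deriv w t) y \<ge> - (1 - \<delta>) / real n) \<longrightarrow>
           harmonic_on (ball 0 1) U \<longrightarrow>
           U 0 = 0 \<longrightarrow>
           (\<forall>z\<in>ball 0 1. U z \<le> w (1 - norm z)) \<longrightarrow>
           (\<forall>z\<in>ball 0 1. \<bar>U z\<bar> \<le> C * w (1 - norm z))"
proof -
  define \<kappa> where "\<kappa> = (1 - \<delta>) / real n"
  define \<alpha> where "\<alpha> = 1 / \<kappa>"
  have dim: "DIM(real ^ 'm) = n + 1"
    using assms(2) by simp
  \<comment> \<open>The constant must be chosen before \<open>w\<close> is given, while \<open>\<kappa> > 0\<close> follows only from the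
    existence of \<open>w\<close>; so positivity of \<open>\<kappa>\<close> is a premise here.\<close>
  obtain K where K: "0 < K" "\<And>(U :: real ^ 'm \<Rightarrow> real) A y0 e t.
    \<kappa> > 0 \<Longrightarrow> harmonic_on (ball 0 1) U \<Longrightarrow> U 0 = 0 \<Longrightarrow> norm e = 1 \<Longrightarrow> 0 \<le> A \<Longrightarrow> 0 \<le> y0 \<Longrightarrow>
    (\<And>z. norm z < 1 - y0 \<Longrightarrow> U z \<le> A * (1 - norm z - y0) powr (- \<alpha>)) \<Longrightarrow>
    0 < t \<Longrightarrow> t \<le> 1 - y0 \<Longrightarrow> - U ((1 - y0 - t) *\<^sub>R e) \<le> K * A * t powr (- \<alpha>)"
  proof (cases "\<kappa> > 0")
    case True
    then have "1 - \<delta> > 0"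
      using assms(1) by (simp add: \<kappa>_def zero_less_divide_iff)
    then have "\<alpha> > real n"
      using assms(1,3) by (simp add: \<alpha>_def \<kappa>_def field_simps)
    from power_growth_lower_bound[OF dim this] show ?thesis
      using that by blast
  next
    case False
    then show ?thesis
      using that[of 1] by simp
  qed
  define C where "C = max 1 (K * exp \<alpha> * 2 powr \<alpha>)"
  have "\<bar>U z\<bar> \<le> C * w (1 - norm z)"
    if pos: "\<forall>y>0. w y > 0" and anti: "strict_antimono_on {0<..} w" and C2: "C2_on {0<..} w"
      and nz: "\<forall>y. 0 < y \<and> y < 1 \<longrightarrow> deriv w y \<noteq> 0"
      and lim: "((\<lambda>y. w y / deriv w y) \<longlongrightarrow> 0) (at_right 0)"
      and ge: "\<forall>y. 0 < y \<and> y < 1 \<longrightarrow> deriv (\<lambda>t. w t / deriv w t) y \<ge> - (1 - \<delta>) / real n"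
      and harm: "harmonic_on (ball 0 1) U" and U0: "U 0 = 0"
      and Ule: "\<forall>z\<in>ball 0 1. U z \<le> w (1 - norm z)" and z: "z \<in> ball 0 1"
    for w :: "real \<Rightarrow> real" and U :: "real ^ 'm \<Rightarrow> real" and z
  proof -
    define q where "q y = - (w y / deriv w y)" for y
    define q' where "q' y = - deriv (\<lambda>t. w t / deriv w t) y" for y
    have anti': "w y \<le> w x" if "0 < x" "x \<le> y" for x y
      using that anti by (cases "x = y") (auto simp: monotone_on_def intro: less_imp_le)
    have w': "(w has_field_derivative deriv w y) (at y)" if "0 < y" for y
      using C2_on_real_DERIV(1)[OF C2] that by simp
    have deriv_neg: "deriv w y < 0" if "0 < y" "y < 1" for y
    proof -
      have "deriv w y \<le> 0"
      proof (rule ccontr)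
        assume "\<not> deriv w y \<le> 0"
        then obtain d where d: "d > 0" and inc: "\<And>h. 0 < h \<Longrightarrow> h < d \<Longrightarrow> w y < w (y + h)"
          using DERIV_pos_inc_right[OF w'[OF \<open>0 < y\<close>]] by auto
        show False
          using anti'[of y "y + d / 2"] inc[of "d / 2"] \<open>0 < y\<close> d by simp
      qed
      with nz that show ?thesis by force
    qed
    have q0: "q y > 0" if "0 < y" "y < 1" for y
      using pos deriv_neg[OF that] that by (simp add: q_def divide_pos_neg)
    have w'q: "(w has_field_derivative - w y / q y) (at y)" if "0 < y" "y < 1" for y
    proof -
      have "w y \<noteq> 0"
        using pos that by force
      then have "- w y / q y = deriv w y"
        using deriv_neg[OF that] by (simp add: q_def)
      then show ?thesis
        using w'[OF that(1)] by simp
    qed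
    have q': "(q has_field_derivative q' y) (at y)" if "0 < y" "y < 1" for y
    proof -
      have "(\<lambda>t. w t / deriv w t) differentiable (at y)"
        using w'[OF that(1)] C2_on_real_DERIV(2)[OF C2, of y] nz that
        by (intro differentiable_divide) (auto simp: real_differentiable_def)
      then have "((\<lambda>t. w t / deriv w t) has_field_derivative deriv (\<lambda>t. w t / deriv w t) y) (at y)"
        by (auto simp: real_differentiable_def DERIV_imp_deriv)
      then show ?thesis
        unfolding q_def[abs_def] q'_def by (rule DERIV_minus)
    qed
    have q'le: "q' y \<le> \<kappa>" if "0 < y" "y < 1" for y
    proof -
      have "- ((1 - \<delta>) / real n) \<le> deriv (\<lambda>t. w t / deriv w t) y"
        using ge that by (simp only: minus_divide_left)
      then show ?thesis
        by (simp add: q'_def \<kappa>_def)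
    qed
    have qlim: "(q \<longlongrightarrow> 0) (at_right 0)"
      using tendsto_minus[OF lim] by (simp add: q_def[abs_def])
    note decay = weight_decay[OF _ anti' q0 w'q q' q'le qlim]
    have \<kappa>: "\<kappa> > 0"
      using decay(1) pos by blast
    define y where "y = 1 - norm z"
    have y: "0 < y" "y \<le> 1"
      using z by (auto simp: y_def)
    have wy: "0 < w y"
      using pos y by simp
    have "- U z \<le> C * w y"
    proof (cases "z = 0")
      case True
      then show ?thesis
        using U0 wy by (simp add: C_def)
    next
      case False
      then have "y < 1"
        by (simp add: y_def)
      then obtain h where h: "0 < h" "h \<le> y / 2"
        and dec: "\<And>t. 0 < t \<Longrightarrow> y - h + t < 1 \<Longrightarrow>
          w (y - h + t) \<le> exp \<alpha> * (t / (2 * h)) powr (- \<alpha>) * w y"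
        using decay(2)[of y] pos y by (auto simp: \<alpha>_def)
      \<comment> \<open>\<open>A * t powr - \<alpha>\<close> is the majorant at distance \<open>t\<close> from the sphere of radius \<open>1 - (y - h)\<close>.\<close>
      define A where "A = exp \<alpha> * (2 * h) powr \<alpha> * w y"
      have "U v \<le> A * (1 - norm v - (y - h)) powr (- \<alpha>)" if v: "norm v < 1 - (y - h)" for v
      proof -
        define t where "t = 1 - norm v - (y - h)"
        have t: "0 < t" "y - h + t = 1 - norm v"
          using v by (auto simp: t_def)
        have "U v \<le> A * t powr (- \<alpha>)"
        proof (cases "v = 0")
          case True
          then show ?thesis
            using U0 wy by (simp add: A_def)
        next
          case False
          have "U v \<le> w (1 - norm v)"
            using Ule v y h by auto
          also have "\<dots> \<le> exp \<alpha> * (t / (2 * h)) powr (- \<alpha>) * w y"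
            using dec[OF t(1)] False by (simp add: t(2))
          also have "(t / (2 * h)) powr (- \<alpha>) = (2 * h) powr \<alpha> * t powr (- \<alpha>)"
            using t h by (simp add: powr_divide powr_minus field_simps)
          finally show ?thesis
            by (simp add: A_def mult_ac)
        qed
        then show ?thesis by (simp add: t_def)
      qed
      then have "- U ((1 - (y - h) - h) *\<^sub>R (z /\<^sub>R norm z)) \<le> K * A * h powr (- \<alpha>)"
        using False h y wy by (intro K(2)[OF \<kappa> harm U0]) (auto simp: A_def)
      moreover have "(1 - (y - h) - h) *\<^sub>R (z /\<^sub>R norm z) = z"
        using False by (simp add: y_def)
      moreover have "K * A * h powr (- \<alpha>) = K * exp \<alpha> * 2 powr \<alpha> * w y"
        using h by (simp add: A_def powr_mult powr_minus field_simps)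
      moreover have "\<dots> \<le> C * w y"
        using wy by (intro mult_right_mono) (auto simp: C_def)
      ultimately show ?thesis by simp
    qed
    moreover have "U z \<le> C * w y"
    proof -
      have "U z \<le> 1 * w y"
        using Ule z by (simp add: y_def)
      also have "\<dots> \<le> C * w y"
        using wy by (intro mult_right_mono) (auto simp: C_def)
      finally show ?thesis .
    qed
    ultimately show ?thesis
      by (simp add: y_def)
  qed
  then show ?thesis
    by blast
qed

end
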